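(* Let $X=MD(G,S_0,S_1,T_0,T_1)$ be max-$\lambda$ but not super-$\lambda$, and suppose $X$ is neither a directed cycle nor a cycle and does not belong to $\mathcal{F}$. Then $X$ belongs to $\mathcal{G}$ if and only if $X$ satisfies one of the following conditions: (1) $|T_0|=1$ or $|T_1|=1$, $1\leq|S_0|\leq|S_1|$, and $S_0\cup\{1_G\}$ is a subgroup of $G$; (2) $|T_0|=1$ or $|T_1|=1$, $1\leq|S_1|\leq|S_0|$, and $S_1\cup\{1_G\}$ is a subgroup of $G$.
   Context: $G$ is a finite group with identity $1_G$, $S_0,S_1\subseteq G\setminus\{1_G\}$, $T_0,T_1\subseteq G$. The mixed Cayley digraph $X=MD(G,S_0,S_1,T_0,T_1)$ has vertex set $G\times\{0,1\}$ and is the union of $\mathrm{Cay}(G\times\{0\},S_0)$ (arcs $((g,0),(sg,0))$, $s\in S_0$), $\mathrm{Cay}(G\times\{1\},S_1)$ (arcs $((g,1),(sg,1))$, $s\in S_1$) and $BD(G,T_0,T_1)$ (arcs $((g,0),(tg,1))$, $t\in T_0$, and $((tg,1),(g,0))$, $t\in T_1$), $g\in G$. $X_i=G\times\{i\}$. $\mathcal{F}$ is the class of such $X$ in which one of $\mathrm{Cay}(G\times\{0\},S_0)$, $\mathrm{Cay}(G\times\{1\},S_1)$ is a union of disjoint directed cycles, the other is a union of disjoint directed cycles of length two, and $BD(G,T_0,T_1)$ is a union of disjoint directed cycles of length two. "Cycle" means a symmetric digraph whose underlying graph is a cycle. $\delta(X)$ is the minimum over all vertices of all in- and out-degrees; $\lambda(X)$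 is the arc-connectivity. For $A\subseteq V(X)$, $\omega^+(A)$ (resp. $\omega^-(A)$) is the set of arcs leaving (resp. entering) $A$. A proper nonempty $A$ is an arc fragment if $|\omega^+(A)|=\lambda(X)$ or $|\omega^-(A)|=\lambda(X)$. A $\lambda$-superatom is an arc fragment with at least two vertices of least possible cardinality among such. $X$ is max-$\lambda$ if $\lambda(X)=\delta(X)$, and super-$\lambda$ if every minimum cut (a set $\omega^+(A)$, $A$ proper nonempty, of cardinality $\lambda(X)$) is the set of all inarcs or all outarcs of some vertex. $\mathcal{G}$ is the class of strongly connected mixed Cayley digraphs having a $\lambda$-superatom contained in $X_0$ or in $X_1$. *)

theory Defs
  imports "HOL-Algebra.Group" "Graph_Theory.Digraph_Component"
begin

section \<open>Mixed Cayley digraphs\<close>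

text \<open>
  Digraphs without parallel arcs are rendered by the pair digraphs of \<^verbatim>\<open>Graph_Theory\<close>.
  The paper multiplies on the left: \<open>g\<close> is joined to \<open>s \<otimes> g\<close>.
\<close>

definition layer :: "('g, 'm) monoid_scheme \<Rightarrow> nat \<Rightarrow> ('g \<times> nat) set" where
  "layer G i = carrier G \<times> {i}"

definition cay :: "('g, 'm) monoid_scheme \<Rightarrow> nat \<Rightarrow> 'g set \<Rightarrow> ('g \<times> nat) pair_pre_digraph" where
  "cay G i S = \<lparr> pverts = layer G i,
     parcs = {((g, i), (s \<otimes>\<^bsub>G\<^esub> g, i)) | g s. g \<in> carrier G \<and> s \<in> S} \<rparr>"

definition bd :: "('g, 'm) monoid_scheme \<Rightarrow> 'g set \<Rightarrow> 'g set \<Rightarrow> ('g \<times> nat) pair_pre_digraph" where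
  "bd G T0 T1 = \<lparr> pverts = layer G 0 \<union> layer G 1,
     parcs = {((g, 0), (t \<otimes>\<^bsub>G\<^esub> g, 1)) | g t. g \<in> carrier G \<and> t \<in> T0}
           \<union> {((t \<otimes>\<^bsub>G\<^esub> g, 1), (g, 0)) | g t. g \<in> carrier G \<and> t \<in> T1} \<rparr>"

definition mixed_cayley ::
    "('g, 'm) monoid_scheme \<Rightarrow> 'g set \<Rightarrow> 'g set \<Rightarrow> 'g set \<Rightarrow> 'g set \<Rightarrow> ('g \<times> nat) pair_pre_digraph"
where
  "mixed_cayley G S0 S1 T0 T1 =
     \<lparr> pverts = pverts (cay G 0 S0) \<union> pverts (cay G 1 S1) \<union> pverts (bd G T0 T1),
       parcs = parcs (cay G 0 S0) \<union> parcs (cay G 1 S1) \<union> parcs (bd G T0 T1) \<rparr>"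


section \<open>Directed cycles and cycles\<close>

text \<open>
  \<^verbatim>\<open>pre_digraph.cycle\<close> admits a single loop as a cycle of length one; the digraphs considered
  here have no loops, and the bound \<open>2 \<le> n\<close> makes this explicit.
\<close>

definition directed_cycle_of_length :: "nat \<Rightarrow> 'a pair_pre_digraph \<Rightarrow> bool" where
  "directed_cycle_of_length n D \<longleftrightarrow> 2 \<le> n \<and>
     (\<exists>p. pre_digraph.cycle (with_proj D) p \<and> length p = n \<and>
          pverts D = fst ` set p \<and> parcs D = set p)"

definition directed_cycle :: "'a pair_pre_digraph \<Rightarrow> bool" where
  "directed_cycle D \<longleftrightarrow> (\<exists>n. directed_cycle_of_length n D)"

text \<open>
  A symmetric digraph whose underlying graph is a cycle: a directed cycle of length at least
  three together with all its reversed arcs.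
\<close>

definition cycle_digraph :: "'a pair_pre_digraph \<Rightarrow> bool" where
  "cycle_digraph D \<longleftrightarrow>
     (\<exists>p. pre_digraph.cycle (with_proj D) p \<and> 3 \<le> length p \<and>
          pverts D = fst ` set p \<and> parcs D = set p \<union> (set p)\<inverse>)"

text \<open>The members of the family have to cover all vertices.\<close>

definition disjoint_union_of ::
    "('a pair_pre_digraph \<Rightarrow> bool) \<Rightarrow> 'a pair_pre_digraph \<Rightarrow> bool" where
  "disjoint_union_of P D \<longleftrightarrow>
     (\<exists>\<C>. (\<forall>C\<in>\<C>. P C) \<and>
          (\<forall>C\<in>\<C>. \<forall>C'\<in>\<C>. C \<noteq> C' \<longrightarrow> pverts C \<inter> pverts C' = {}) \<and>
          pverts D = (\<Union>C\<in>\<C>. pverts C) \<and> parcs D = (\<Union>C\<in>\<C>. parcs C))"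

definition class_F ::
    "('g, 'm) monoid_scheme \<Rightarrow> 'g set \<Rightarrow> 'g set \<Rightarrow> 'g set \<Rightarrow> 'g set \<Rightarrow> bool" where
  "class_F G S0 S1 T0 T1 \<longleftrightarrow>
     (disjoint_union_of directed_cycle (cay G 0 S0) \<and>
        disjoint_union_of (directed_cycle_of_length 2) (cay G 1 S1) \<or>
      disjoint_union_of directed_cycle (cay G 1 S1) \<and>
        disjoint_union_of (directed_cycle_of_length 2) (cay G 0 S0)) \<and>
     disjoint_union_of (directed_cycle_of_length 2) (bd G T0 T1)"


section \<open>Arc-connectivity\<close>

definition min_degree :: "'a pair_pre_digraph \<Rightarrow> nat" where
  "min_degree D = Min (out_degree (with_proj D) ` pverts D \<union> in_degree (with_proj D) ` pverts D)"

text \<open>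
  The least number of arcs whose deletion destroys strong connectivity; meaningful for finite
  digraphs with at least two vertices.
\<close>

definition arc_connectivity :: "'a pair_pre_digraph \<Rightarrow> nat" where
  "arc_connectivity D =
     (LEAST k. \<exists>W \<subseteq> parcs D. card W = k \<and>
        \<not> strongly_connected (with_proj \<lparr> pverts = pverts D, parcs = parcs D - W \<rparr>))"

definition omega_plus :: "'a pair_pre_digraph \<Rightarrow> 'a set \<Rightarrow> ('a \<times> 'a) set" where
  "omega_plus D A = {e \<in> parcs D. fst e \<in> A \<and> snd e \<notin> A}"

definition omega_minus :: "'a pair_pre_digraph \<Rightarrow> 'a set \<Rightarrow> ('a \<times> 'a) set" where
  "omega_minus D A = {e \<in> parcs D. fst e \<notin> A \<and> snd e \<in> A}"

definition arc_fragment :: "'a pair_pre_digraph \<Rightarrow> 'a set \<Rightarrow> bool" where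
  "arc_fragment D A \<longleftrightarrow> A \<noteq> {} \<and> A \<subset> pverts D \<and>
     (card (omega_plus D A) = arc_connectivity D \<or> card (omega_minus D A) = arc_connectivity D)"

definition lambda_superatom :: "'a pair_pre_digraph \<Rightarrow> 'a set \<Rightarrow> bool" where
  "lambda_superatom D A \<longleftrightarrow> arc_fragment D A \<and> 2 \<le> card A \<and>
     (\<forall>B. arc_fragment D B \<and> 2 \<le> card B \<longrightarrow> card A \<le> card B)"

definition max_lambda :: "'a pair_pre_digraph \<Rightarrow> bool" where
  "max_lambda D \<longleftrightarrow> arc_connectivity D = min_degree D"

definition super_lambda :: "'a pair_pre_digraph \<Rightarrow> bool" where
  "super_lambda D \<longleftrightarrow>
     (\<forall>A. A \<noteq> {} \<and> A \<subset> pverts D \<and> card (omega_plus D A) = arc_connectivity D \<longrightarrow>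
        (\<exists>v \<in> pverts D. omega_plus D A = in_arcs (with_proj D) v \<or>
                         omega_plus D A = out_arcs (with_proj D) v))"

definition class_G ::
    "('g, 'm) monoid_scheme \<Rightarrow> 'g set \<Rightarrow> 'g set \<Rightarrow> 'g set \<Rightarrow> 'g set \<Rightarrow> bool" where
  "class_G G S0 S1 T0 T1 \<longleftrightarrow>
     strongly_connected (with_proj (mixed_cayley G S0 S1 T0 T1)) \<and>
     (\<exists>A. lambda_superatom (mixed_cayley G S0 S1 T0 T1) A \<and> (A \<subseteq> layer G 0 \<or> A \<subseteq> layer G 1))"

end

theory Submission
  imports Defs
begin

text \<open>
  If \<open>B\<close> has \<open>k\<close> vertices, every vertex of \<open>B\<close> sends at least \<open>\<delta> - (k - 1)\<close> arcs out of \<open>B\<close>,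
  and \<open>k (\<delta> - k + 1) > \<delta>\<close> when \<open>2 \<le> k < \<delta>\<close>. So if \<open>\<lambda> = \<delta>\<close>, an arc fragment with at least
  two vertices has at least \<open>\<delta>\<close> vertices. If such a fragment \<open>C\<close> lies in one layer, it loses
  \<open>|C| |T|\<close> arcs to the other layer, where \<open>T\<close> is nonempty by strong connectivity, and
  \<open>|C| |T| \<le> \<delta> \<le> |C|\<close> forces \<open>|T| = 1\<close>, \<open>|C| = \<delta>\<close> and that \<open>C\<close> is closed under \<open>S\<close>; as
  \<open>\<delta> \<le> |S| + 1\<close>, the set \<open>C\<close> is a coset of \<open>S \<union> {1}\<close>, which is then a subgroup. Conversely,
  if \<open>|T| = 1\<close>, the subgroup \<open>S \<union> {1}\<close> itself, placed in its layer, is an arc fragment with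
  exactly \<open>\<delta>\<close> vertices.
\<close>

section \<open>Arcs leaving a small vertex set\<close>

text \<open>Stated for a bare relation so that it applies to the arc set and to its converse alike;
  entering arcs become leaving arcs of the converse.\<close>

definition leaving :: "('a \<times> 'a) set \<Rightarrow> 'a set \<Rightarrow> ('a \<times> 'a) set" where
  "leaving R A = {e \<in> R. fst e \<in> A \<and> snd e \<notin> A}"

lemma card_leaving_gt:
  assumes fin: "finite R" and irr: "\<And>v. (v, v) \<notin> R" and B: "2 \<le> card B" "card B < d"
    and deg: "\<And>v. v \<in> B \<Longrightarrow> d \<le> card (R `` {v})"
  shows "d < card (leaving R B)"
proof -
  have finB: "finite B" using B(1) by (metis card.infinite not_numeral_le_zero)
  have finI: "finite (R `` {v})" for v
    using fin by (rule finite_Image)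
  have le: "d - (card B - 1) \<le> card (R `` {v} - B)" if v: "v \<in> B" for v
  proof -
    \<comment> \<open>In the absence of loops, at most \<open>card B - 1\<close> successors of
      \<open>v\<close> lie inside \<open>B\<close>.\<close>
    have "R `` {v} \<subseteq> (B - {v}) \<union> (R `` {v} - B)" using irr by auto
    then have "card (R `` {v}) \<le> card ((B - {v}) \<union> (R `` {v} - B))"
      using finB finI by (intro card_mono) auto
    also have "\<dots> \<le> card (B - {v}) + card (R `` {v} - B)" by (rule card_Un_le)
    also have "card (B - {v}) = card B - 1" using v finB by simp
    finally show ?thesis using deg[OF v] by linarith
  qed
  \<comment> \<open>With \<open>card B = k + 2\<close> and \<open>d = k + m + 3\<close> the
    truncated subtractions disappear, and the claim becomes
    \<open>k + m + 3 < (k + 2) * (m + 2)\<close>.\<close>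
  obtain m where m: "d = card B + Suc m" using B(2) less_iff_Suc_add by auto
  obtain k where k: "card B = Suc (Suc k)" using B(1) by (metis add_2_eq_Suc le_Suc_ex)
  have "leaving R B = (SIGMA v:B. R `` {v} - B)" by (auto simp: leaving_def)
  then have "card (leaving R B) = (\<Sum>v\<in>B. card (R `` {v} - B))"
    using finB finI by (simp add: card_SigmaI)
  also have "\<dots> \<ge> card B * (d - (card B - 1))"
    using sum_bounded_below[of B "d - (card B - 1)"] le by simp
  finally show ?thesis unfolding m k by simp
qed

section \<open>Subgroups of the form \<open>S \<union> {\<one>}\<close>\<close>

text \<open>Right translation by \<open>a\<close> injects \<open>S \<union> {\<one>}\<close> into
  \<open>C\<close>, and the cardinality bound makes it onto. Since \<open>C\<close> is closed under
  \<open>S\<close>, the product \<open>x \<otimes> y \<otimes> a\<close> lies in \<open>C\<close>,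
  so cancelling \<open>a\<close> puts \<open>x \<otimes> y\<close> into
  \<open>S \<union> {\<one>}\<close>.\<close>

lemma (in group) subgroup_if_mult_closed_coset:
  assumes fin: "finite (carrier G)" and S: "S \<subseteq> carrier G - {\<one>}" and C: "C \<subseteq> carrier G"
    and a: "a \<in> C" and closed: "\<And>g s. g \<in> C \<Longrightarrow> s \<in> S \<Longrightarrow> s \<otimes> g \<in> C"
    and card: "card C \<le> card S + 1"
  shows "subgroup (S \<union> {\<one>}) G" and "card C = card S + 1"
proof -
  let ?H = "S \<union> {\<one>}"
  have aG: "a \<in> carrier G" using a C by auto
  have HG: "?H \<subseteq> carrier G" using S by auto
  have finH: "finite ?H" using HG fin by (rule finite_subset)
  have cH: "card ?H = card S + 1"
    using S finH by (subst card_Un_disjoint) auto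
  have inj: "inj_on (\<lambda>h. h \<otimes> a) ?H"
    using HG aG by (intro inj_onI) (metis right_cancel subsetD)
  have sub: "(\<lambda>h. h \<otimes> a) ` ?H \<subseteq> C" using a aG closed by auto
  have finC: "finite C" using C fin by (rule finite_subset)
  have eq: "(\<lambda>h. h \<otimes> a) ` ?H = C"
    using card_seteq[OF finC sub] card card_image[OF inj] cH by simp
  show "card C = card S + 1" using eq card_image[OF inj] cH by simp
  have mult: "x \<otimes> y \<in> ?H" if x: "x \<in> ?H" and y: "y \<in> ?H" for x y
  proof (cases "x = \<one>")
    case True then show ?thesis using y HG by auto
  next
    case False
    then have "x \<otimes> (y \<otimes> a) \<in> C" using x y sub closed by auto
    then obtain h where h: "h \<in> ?H" "x \<otimes> (y \<otimes> a) = h \<otimes> a" using eq by blast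
    have xG: "x \<in> carrier G" and yG: "y \<in> carrier G" and hG: "h \<in> carrier G"
      using x y h HG by blast+
    have "(x \<otimes> y) \<otimes> a = h \<otimes> a" using h(2) xG yG aG by (simp add: m_assoc)
    then have "x \<otimes> y = h" using xG yG hG aG by simp
    then show ?thesis using h(1) by simp
  qed
  show "subgroup ?H G"
  proof (rule subgroupI)
    fix x assume x: "x \<in> ?H"
    have xG: "x \<in> carrier G" using x HG by auto
    have "inj_on (\<lambda>h. x \<otimes> h) ?H"
      using HG xG by (intro inj_onI) (metis Units_l_cancel Units_eq subsetD)
    \<comment> \<open>An injective self-map of a finite set is surjective, so \<open>\<one>\<close>
      is hit; its preimage is the inverse of \<open>x\<close>.\<close>
    then have "(\<lambda>h. x \<otimes> h) ` ?H = ?H"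
      using mult[OF x] finH by (intro endo_inj_surj) auto
    then obtain h where h: "h \<in> ?H" "\<one> = x \<otimes> h" by blast
    have hG: "h \<in> carrier G" using h(1) HG by blast
    have "inv x = inv x \<otimes> (x \<otimes> h)" using h(2)[symmetric] xG by simp
    also have "\<dots> = h" using xG hG by (simp add: m_assoc[symmetric])
    finally show "inv x \<in> ?H" using h by simp
  qed (use HG mult in auto)
qed

lemma (in group) inv_image_subgroup:
  assumes H: "subgroup H G" shows "m_inv G ` H = H"
proof
  show "m_inv G ` H \<subseteq> H" using subgroup.m_inv_closed[OF H] by blast
  show "H \<subseteq> m_inv G ` H"
  proof
    fix h assume h: "h \<in> H"
    then have "inv (inv h) = h" using subgroup.mem_carrier[OF H] by simp
    then show "h \<in> m_inv G ` H" using subgroup.m_inv_closed[OF H h] by (metis imageI)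
  qed
qed

text \<open>Reversing all arcs replaces connection sets by their inverses; this carries a subgroup
  found for the reversed digraph back. Both directions are the same argument, because inversion is
  an involution.\<close>

lemma (in group) subgroup_insert_one_inv_iff:
  assumes "S \<subseteq> carrier G"
  shows "subgroup (m_inv G ` S \<union> {\<one>}) G \<longleftrightarrow> subgroup (S \<union> {\<one>}) G"
proof -
  have im: "m_inv G ` (A \<union> {\<one>}) = m_inv G ` A \<union> {\<one>}" for A by auto
  have ii: "m_inv G ` (m_inv G ` S) = S"
    using assms by (force simp: image_iff)
  show ?thesis
  proof
    assume "subgroup (m_inv G ` S \<union> {\<one>}) G"
    then show "subgroup (S \<union> {\<one>}) G"
      using inv_image_subgroup im[of "m_inv G ` S"] ii by metis
  next
    assume "subgroup (S \<union> {\<one>}) G"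
    then show "subgroup (m_inv G ` S \<union> {\<one>}) G"
      using inv_image_subgroup im[of S] by metis
  qed
qed

lemma (in group) inv_image_Un_one:
  assumes "subgroup (S \<union> {\<one>}) G" shows "m_inv G ` S \<union> {\<one>} = S \<union> {\<one>}"
  using inv_image_subgroup[OF assms] by simp

lemma (in group) card_inv_image: "S \<subseteq> carrier G \<Longrightarrow> card (m_inv G ` S) = card S"
  by (metis card_image inj_on_subset inv_inj)

section \<open>Arcs, degrees and cuts in a two-layer Cayley digraph\<close>

text \<open>
  In the mixed Cayley digraph the arcs leaving layer \<open>1\<close> are given by inverses of elements of
  \<open>T1\<close>; with \<open>U 0 = T0\<close> and \<open>U 1 = T1\<inverse>\<close> both layers, and also both orientations, obey the same
  rule.
\<close>

locale bicayley = group G for G (structure) +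
  fixes S U :: "nat \<Rightarrow> 'a set"
  assumes finite_G: "finite (carrier G)"
    and S_sub: "S i \<subseteq> carrier G - {\<one>}" and U_sub: "U i \<subseteq> carrier G"
begin

text \<open>The term \<open>1 - i\<close> exchanges the layers 0 and 1. With truncated subtraction
  it differs from \<open>i\<close> for every natural \<open>i\<close>, whereas
  \<open>1 - (1 - i) = i\<close> relies on \<open>i < 2\<close>.\<close>

definition bi_arcs :: "(('a \<times> nat) \<times> ('a \<times> nat)) set" where
  "bi_arcs = {((g, i), (s \<otimes> g, i)) | g i s. g \<in> carrier G \<and> i < 2 \<and> s \<in> S i}
     \<union> {((g, i), (u \<otimes> g, 1 - i)) | g i u. g \<in> carrier G \<and> i < 2 \<and> u \<in> U i}"

lemma bi_arcsI:
  assumes "g \<in> carrier G" and "i < 2"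
  shows "s \<in> S i \<Longrightarrow> ((g, i), (s \<otimes> g, i)) \<in> bi_arcs"
    and "u \<in> U i \<Longrightarrow> ((g, i), (u \<otimes> g, 1 - i)) \<in> bi_arcs"
  using assms unfolding bi_arcs_def by auto

lemma bi_arcsE:
  assumes "(x, y) \<in> bi_arcs"
  obtains (S) g i s where "x = (g, i)" "y = (s \<otimes> g, i)" "g \<in> carrier G" "i < 2" "s \<in> S i"
    | (U) g i u where "x = (g, i)" "y = (u \<otimes> g, 1 - i)" "g \<in> carrier G" "i < 2" "u \<in> U i"
  using assms unfolding bi_arcs_def by auto

lemma bi_arcs_sub: "bi_arcs \<subseteq> (carrier G \<times> {..<2}) \<times> (carrier G \<times> {..<2})"
  using S_sub U_sub unfolding bi_arcs_def by fastforce

lemma finite_bi_arcs: "finite bi_arcs"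
  using bi_arcs_sub finite_G by (meson finite_SigmaI finite_lessThan finite_subset)

lemma bi_arcs_irrefl: "(v, v) \<notin> bi_arcs"
proof
  assume v: "(v, v) \<in> bi_arcs"
  obtain g i where gi: "v = (g, i)" by fastforce
  from v gi consider s where "g \<in> carrier G" "s \<in> S i" "g = s \<otimes> g" | "i < 2" "i = 1 - i"
    unfolding bi_arcs_def by auto
  then show False
  proof cases
    case 1
    then show ?thesis using S_sub[of i] r_cancel_one'[of g s] by auto
  next
    case 2 then show ?thesis by arith
  qed
qed

lemma finite_S: "finite (S i)" and finite_U: "finite (U i)"
  using finite_G S_sub[of i] U_sub[of i] by (meson Diff_subset finite_subset subset_trans)+

lemma card_Image_bi_arcs:
  assumes g: "g \<in> carrier G" and i: "i < 2"
  shows "card (bi_arcs `` {(g, i)}) = card (S i) + card (U i)"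
proof -
  have eq: "bi_arcs `` {(g, i)} = (\<lambda>s. (s \<otimes> g, i)) ` S i \<union> (\<lambda>u. (u \<otimes> g, 1 - i)) ` U i"
    using g i by (auto simp: bi_arcs_def)
  have "inj_on (\<lambda>s. (s \<otimes> g, i)) (S i)" "inj_on (\<lambda>u. (u \<otimes> g, 1 - i)) (U i)"
    using g S_sub[of i] U_sub[of i] by (auto intro!: inj_onI simp: subset_iff)
  moreover have "i \<noteq> 1 - i" by arith
  ultimately show ?thesis unfolding eq
    using finite_S finite_U by (subst card_Un_disjoint) (auto simp: card_image)
qed

lemma bicayley_converse: "bicayley G (\<lambda>i. m_inv G ` S i) (\<lambda>i. m_inv G ` U (1 - i))"
proof unfold_locales
  fix i
  show "m_inv G ` S i \<subseteq> carrier G - {\<one>}"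
    using S_sub[of i] by (auto simp: inv_eq_1_iff)
  show "m_inv G ` U (1 - i) \<subseteq> carrier G" using U_sub[of "1 - i"] by auto
qed (rule finite_G)

text \<open>The reverse of an arc from \<open>g\<close> to \<open>h = s \<otimes> g\<close> goes
  from \<open>h\<close> to \<open>inv s \<otimes> h\<close>. Arcs entering layer \<open>i\<close>
  from the other layer come from \<open>U (1 - i)\<close>, hence the index shift in the reversed
  digraph. Every statement on leaving arcs thereby yields one on entering arcs.\<close>

lemma bi_arcs_converse:
  "bi_arcs\<inverse> = bicayley.bi_arcs G (\<lambda>i. m_inv G ` S i) (\<lambda>i. m_inv G ` U (1 - i))"
proof -
  interpret c: bicayley G "\<lambda>i. m_inv G ` S i" "\<lambda>i. m_inv G ` U (1 - i)"
    by (rule bicayley_converse)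
  have l: "inv s \<otimes> (s \<otimes> g) = g" "s \<otimes> (inv s \<otimes> g) = g"
    if "s \<in> carrier G" "g \<in> carrier G" for s g
    using that by (simp_all add: m_assoc[symmetric])
  have SG: "s \<in> S i \<Longrightarrow> s \<in> carrier G" and UG: "s \<in> U i \<Longrightarrow> s \<in> carrier G" for s i
    using S_sub U_sub by auto
  have "(y, x) \<in> c.bi_arcs" if "(x, y) \<in> bi_arcs" for x y
    using that
  proof (cases rule: bi_arcsE)
    case (S g i s)
    have "((s \<otimes> g, i), (inv s \<otimes> (s \<otimes> g), i)) \<in> c.bi_arcs"
      using S SG by (intro c.bi_arcsI imageI m_closed)
    then show ?thesis using S SG l by simp
  next
    case (U g i u)
    have i: "1 - (1 - i) = i" "1 - i < 2" using U(4) by arith+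
    have "((u \<otimes> g, 1 - i), (inv u \<otimes> (u \<otimes> g), 1 - (1 - i))) \<in> c.bi_arcs"
      using U UG i by (intro c.bi_arcsI imageI m_closed) simp_all
    then show ?thesis using U UG l i by simp
  qed
  moreover have "(y, x) \<in> bi_arcs" if "(x, y) \<in> c.bi_arcs" for x y
    using that
  proof (cases rule: c.bi_arcsE)
    case (S g i s')
    then obtain s where s: "s \<in> S i" "s' = inv s" by blast
    have "((inv s \<otimes> g, i), (s \<otimes> (inv s \<otimes> g), i)) \<in> bi_arcs"
      using S s SG by (intro bi_arcsI m_closed inv_closed)
    then show ?thesis using S s SG l by simp
  next
    case (U g i u')
    then obtain u where u: "u \<in> U (1 - i)" "u' = inv u" by blast
    have i: "1 - (1 - i) = i" "1 - i < 2" using U(4) by arith+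
    have "((inv u \<otimes> g, 1 - i), (u \<otimes> (inv u \<otimes> g), 1 - (1 - i))) \<in> bi_arcs"
      using U u UG i by (intro bi_arcsI m_closed inv_closed) simp_all
    then show ?thesis using U u UG l i by simp
  qed
  ultimately show ?thesis by auto
qed

lemma card_Image_converse_bi_arcs:
  assumes "g \<in> carrier G" and "i < 2"
  shows "card (bi_arcs\<inverse> `` {(g, i)}) = card (S i) + card (U (1 - i))"
proof -
  interpret c: bicayley G "\<lambda>i. m_inv G ` S i" "\<lambda>i. m_inv G ` U (1 - i)"
    by (rule bicayley_converse)
  have "S i \<subseteq> carrier G" using S_sub[of i] by auto
  then show ?thesis
    unfolding bi_arcs_converse using c.card_Image_bi_arcs[OF assms] U_sub
    by (simp add: card_inv_image)
qed

text \<open>Here \<open>C\<close> is the projection to the group of a fragment inside one layer, and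
  \<open>d\<close> plays the role of the minimum degree. The cut has to consist of the
  \<open>card C * card (U i)\<close> arcs to the other layer and nothing else.\<close>

lemma fragment_in_layer:
  assumes C: "C \<subseteq> carrier G" "2 \<le> card C" and i: "i < 2"
    and cut: "card (leaving bi_arcs (C \<times> {i})) = d"
    and out: "\<And>g i. g \<in> carrier G \<Longrightarrow> i < 2 \<Longrightarrow> d \<le> card (bi_arcs `` {(g, i)})"
    and inn: "\<And>g i. g \<in> carrier G \<Longrightarrow> i < 2 \<Longrightarrow> d \<le> card (bi_arcs\<inverse> `` {(g, i)})"
    and U: "U i \<noteq> {}"
  shows "card (U i) = 1" and "1 \<le> card (S i)" and "card (S i) \<le> card (S (1 - i))"
    and "subgroup (S i \<union> {\<one>}) G"
proof -
  have i': "1 - i < 2" "1 - (1 - i) = i" "1 - i \<noteq> i" using i by arith+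
  \<comment> \<open>The second bound is an in-degree in the other layer: arcs entering layer
    \<open>1 - i\<close> from outside also come from \<open>U i\<close>. It will give the comparison
    of \<open>S i\<close> with \<open>S (1 - i)\<close>.\<close>
  have d_le: "d \<le> card (S i) + card (U i)" "d \<le> card (S (1 - i)) + card (U i)"
    using out[OF one_closed i] inn[OF one_closed i'(1)] i i'
    by (simp_all only: card_Image_bi_arcs card_Image_converse_bi_arcs one_closed)
  have dC: "d \<le> card C"
  proof (rule ccontr)
    assume "\<not> d \<le> card C"
    then have "d < card (leaving bi_arcs (C \<times> {i}))"
      using C i by (intro card_leaving_gt finite_bi_arcs bi_arcs_irrefl out)
        (auto simp: card_cartesian_product intro: out)
    with cut show False by simp
  qed
  let ?f = "\<lambda>(g, u). ((g, i), (u \<otimes> g, 1 - i))"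
  have inj: "inj_on ?f (C \<times> U i)"
    using C U_sub[of i] by (auto intro!: inj_onI simp: subset_iff)
  have sub: "?f ` (C \<times> U i) \<subseteq> leaving bi_arcs (C \<times> {i})"
    using C i i' unfolding leaving_def bi_arcs_def by force
  have finL: "finite (leaving bi_arcs (C \<times> {i}))"
    using finite_bi_arcs unfolding leaving_def by simp
  have cf: "card (?f ` (C \<times> U i)) = card C * card (U i)"
    using card_image[OF inj] by (simp add: card_cartesian_product)
  have le: "card C * card (U i) \<le> d"
    using card_mono[OF finL sub] cf cut by simp
  have U0: "card (U i) \<noteq> 0" using U finite_U by auto
  have "card C * card (U i) \<le> card C * 1" using le dC by linarith
  then have "card (U i) \<le> 1" using C(2) mult_le_cancel1 by fastforce
  then show U1: "card (U i) = 1" using U0 by linarith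
  \<comment> \<open>The arcs to the other layer already exhaust the cut, so no arc inside the layer
    leaves \<open>C\<close>.\<close>
  have all: "?f ` (C \<times> U i) = leaving bi_arcs (C \<times> {i})"
    using card_seteq[OF finL sub] cf cut U1 dC by simp
  have closed: "s \<otimes> g \<in> C" if "g \<in> C" "s \<in> S i" for g s
  proof (rule ccontr)
    assume "s \<otimes> g \<notin> C"
    then have "((g, i), (s \<otimes> g, i)) \<in> leaving bi_arcs (C \<times> {i})"
      using that i C unfolding leaving_def bi_arcs_def by auto
    then have "((g, i), (s \<otimes> g, i)) \<in> ?f ` (C \<times> U i)" unfolding all .
    then show False using i' by auto
  qed
  obtain a where a: "a \<in> C" using C(2) by fastforce
  have "card C \<le> card (S i) + 1" using le U1 d_le by simp
  note coset = subgroup_if_mult_closed_coset[OF finite_G S_sub C(1) a closed this]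
  show "subgroup (S i \<union> {\<one>}) G" by (rule coset(1))
  show "1 \<le> card (S i)" using coset(2) C(2) by simp
  show "card (S i) \<le> card (S (1 - i))" using coset(2) le U1 d_le(2) by simp
qed

text \<open>Left multiplication by elements of \<open>S i\<close> stays in the subgroup, so only
  arcs to the other layer leave, exactly one from each vertex.\<close>

lemma card_leaving_subgroup:
  assumes i: "i < 2" and H: "subgroup (S i \<union> {\<one>}) G" and U: "card (U i) = 1"
  shows "card (leaving bi_arcs ((S i \<union> {\<one>}) \<times> {i})) = card (S i) + 1"
proof -
  let ?H = "S i \<union> {\<one>}"
  have i': "1 - i \<noteq> i" by arith
  have HG: "?H \<subseteq> carrier G" using S_sub[of i] by auto
  obtain u where u: "U i = {u}" using U card_1_singletonE by blast
  have cH: "card ?H = card (S i) + 1"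
    using S_sub[of i] finite_S by (subst card_Un_disjoint) auto
  have "leaving bi_arcs (?H \<times> {i}) = (\<lambda>g. ((g, i), (u \<otimes> g, 1 - i))) ` ?H"
  proof (intro equalityI subsetI)
    fix e assume e: "e \<in> leaving bi_arcs (?H \<times> {i})"
    obtain x y where xy: "e = (x, y)" by (cases e)
    have "(x, y) \<in> bi_arcs" using e xy unfolding leaving_def by simp
    then show "e \<in> (\<lambda>g. ((g, i), (u \<otimes> g, 1 - i))) ` ?H"
    proof (cases rule: bi_arcsE)
      case (S g j s)
      have gs: "g \<in> ?H" "j = i" "s \<otimes> g \<notin> ?H" using e xy S unfolding leaving_def by auto
      then have "s \<otimes> g \<in> ?H" using subgroup.m_closed[OF H, of s g] S by blast
      with gs show ?thesis by blast
    next
      case (U g j u')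
      then show ?thesis using e xy u unfolding leaving_def by auto
    qed
  next
    fix e assume "e \<in> (\<lambda>g. ((g, i), (u \<otimes> g, 1 - i))) ` ?H"
    then show "e \<in> leaving bi_arcs (?H \<times> {i})"
      using HG u i i' unfolding leaving_def bi_arcs_def by auto
  qed
  moreover have "inj_on (\<lambda>g. ((g, i), (u \<otimes> g, 1 - i))) ?H" by (auto intro: inj_onI)
  ultimately show ?thesis using cH by (simp only: card_image)
qed

end

section \<open>Strong connectivity, degrees and fragments of pair digraphs\<close>

lemma leaving_nonempty:
  assumes sc: "strongly_connected (with_proj D)" and A: "A \<noteq> {}" "A \<subset> pverts D"
  shows "leaving (parcs D) A \<noteq> {}"
proof
  assume none: "leaving (parcs D) A = {}"
  obtain a b where ab: "a \<in> A" "b \<in> pverts D" "b \<notin> A" using A by auto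
  have "a \<rightarrow>\<^sup>*\<^bsub>with_proj D\<^esub> b"
    using sc ab A unfolding strongly_connected_def by auto
  \<comment> \<open>Without leaving arcs, membership in \<open>A\<close> propagates along a walk
    from \<open>a\<close>.\<close>
  then have "b \<in> A" unfolding reachable_def
    by (induct rule: rtrancl_on_induct) (use ab none in \<open>auto simp: leaving_def\<close>)
  with ab show False by simp
qed

text \<open>If strong connectivity already fails, deleting the empty set of arcs witnesses the value
  0.\<close>

lemma strongly_connected_if_arc_connectivity_pos:
  assumes "arc_connectivity D \<noteq> 0" shows "strongly_connected (with_proj D)"
proof (rule ccontr)
  assume "\<not> strongly_connected (with_proj D)"
  then have "\<exists>W\<subseteq>parcs D. card W = 0 \<and>
      \<not> strongly_connected (with_proj \<lparr>pverts = pverts D, parcs = parcs D - W\<rparr>)"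
    by (intro exI[of _ "{}"]) (cases D, simp)
  then have "arc_connectivity D \<le> 0" unfolding arc_connectivity_def by (rule Least_le)
  with assms show False by simp
qed

lemma card_omega_minus: "card (omega_minus D A) = card (leaving ((parcs D)\<inverse>) A)"
proof -
  have "omega_minus D A = (leaving ((parcs D)\<inverse>) A)\<inverse>"
    unfolding omega_minus_def leaving_def by auto
  then show ?thesis by (simp add: card_inverse)
qed

lemma omega_plus_eq_leaving: "omega_plus D A = leaving (parcs D) A"
  unfolding omega_plus_def leaving_def ..

lemma out_degree_with_proj: "out_degree (with_proj D) v = card (parcs D `` {v})"
proof -
  have "out_arcs (with_proj D) v = Pair v ` (parcs D `` {v})" by (auto simp: out_arcs_def)
  then show ?thesis unfolding out_degree_def by (simp add: card_image inj_on_def)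
qed

lemma in_degree_with_proj: "in_degree (with_proj D) v = card ((parcs D)\<inverse> `` {v})"
proof -
  have "in_arcs (with_proj D) v = (\<lambda>u. (u, v)) ` ((parcs D)\<inverse> `` {v})" by (auto simp: in_arcs_def)
  then show ?thesis unfolding in_degree_def by (simp add: card_image inj_on_def)
qed

lemma min_degree_le:
  assumes "finite (pverts D)" and "v \<in> pverts D"
  shows "min_degree D \<le> card (parcs D `` {v})" and "min_degree D \<le> card ((parcs D)\<inverse> `` {v})"
  using assms unfolding min_degree_def
  by (auto intro!: Min_le simp flip: out_degree_with_proj in_degree_with_proj)

lemma min_degree_ge:
  assumes "finite (pverts D)" and "pverts D \<noteq> {}"
    and "\<And>v. v \<in> pverts D \<Longrightarrow> d \<le> card (parcs D `` {v}) \<and> d \<le> card ((parcs D)\<inverse> `` {v})"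
  shows "d \<le> min_degree D"
  using assms unfolding min_degree_def
  by (intro Min.boundedI) (auto simp: out_degree_with_proj in_degree_with_proj)

text \<open>For a smaller set with at least two vertices, \<open>card_leaving_gt\<close>, applied to
  the arcs and to their converse, makes both cuts larger than the minimum degree, which here equals
  the arc-connectivity.\<close>

lemma arc_fragment_card_ge:
  assumes max: "max_lambda D" and fin: "finite (pverts D)" "finite (parcs D)"
    and irr: "\<And>v. (v, v) \<notin> parcs D" and B: "arc_fragment D B" "2 \<le> card B"
  shows "min_degree D \<le> card B"
proof (rule ccontr)
  assume less: "\<not> min_degree D \<le> card B"
  have sub: "B \<subseteq> pverts D" using B(1) unfolding arc_fragment_def by auto
  have "min_degree D < card (leaving (parcs D) B)"
    using less sub by (intro card_leaving_gt fin irr B(2) min_degree_le(1)) auto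
  moreover have "min_degree D < card (leaving ((parcs D)\<inverse>) B)"
    using less sub fin irr B(2) by (intro card_leaving_gt min_degree_le(2)) auto
  ultimately show False
    using B(1) max unfolding arc_fragment_def max_lambda_def omega_plus_eq_leaving card_omega_minus
    by auto
qed

section \<open>Superatoms contained in a layer\<close>

context bicayley
begin

text \<open>A fragment is witnessed by leaving or by entering arcs; the second case is the first one
  in the reversed digraph, where \<open>U (1 - i)\<close> takes the place of \<open>U i\<close>.
  This is why either of \<open>U 0\<close> and \<open>U 1\<close> may be the singleton.\<close>

lemma superatom_in_layer_iff:
  assumes verts: "pverts D = carrier G \<times> {..<2}" and arcs: "parcs D = bi_arcs"
    and max: "max_lambda D"
  shows "strongly_connected (with_proj D) \<and>
      (\<exists>A. lambda_superatom D A \<and> (\<exists>i<2. A \<subseteq> carrier G \<times> {i})) \<longleftrightarrow>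
    (\<exists>i<2. (card (U 0) = 1 \<or> card (U 1) = 1) \<and> 1 \<le> card (S i) \<and> card (S i) \<le> card (S (1 - i))
      \<and> subgroup (S i \<union> {\<one>}) G)"
    (is "?sc \<and> ?atom \<longleftrightarrow> ?R")
proof -
  interpret c: bicayley G "\<lambda>i. m_inv G ` S i" "\<lambda>i. m_inv G ` U (1 - i)"
    by (rule bicayley_converse)
  let ?d = "min_degree D"
  have finV: "finite (pverts D)" using verts finite_G by simp
  have lam: "arc_connectivity D = ?d" using max unfolding max_lambda_def .
  have SG: "S i \<subseteq> carrier G" for i using S_sub[of i] by auto
  have out: "?d \<le> card (bi_arcs `` {(g, i)})" and inn: "?d \<le> card (bi_arcs\<inverse> `` {(g, i)})"
    if "g \<in> carrier G" "i < 2" for g i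
    using min_degree_le[OF finV, of "(g, i)"] that verts arcs by auto
  \<comment> \<open>Some arc leaves layer \<open>i\<close> by strong connectivity, and only an
    element of \<open>U i\<close> can provide it.\<close>
  have U_ne: "U i \<noteq> {}" if ?sc and i: "i < 2" for i
  proof -
    have i': "1 - i < 2" "1 - i \<noteq> i" by arith+
    have "(\<one>, 1 - i) \<in> pverts D" "(\<one>, 1 - i) \<notin> carrier G \<times> {i}" "(\<one>, i) \<in> carrier G \<times> {i}"
      using verts i' by auto
    then have "leaving (parcs D) (carrier G \<times> {i}) \<noteq> {}"
      using verts i by (intro leaving_nonempty \<open>?sc\<close>) auto
    then obtain x y where xy: "(x, y) \<in> bi_arcs" "x \<in> carrier G \<times> {i}" "y \<notin> carrier G \<times> {i}"
      using arcs unfolding leaving_def by auto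
    from xy(1) show ?thesis
    proof (cases rule: bi_arcsE)
      case (S g j s)
      then have "s \<otimes> g \<in> carrier G" using SG[of j] by auto
      with S xy show ?thesis by auto
    next
      case (U g j u)
      with xy show ?thesis by auto
    qed
  qed
  show ?thesis
  proof
    assume L: "?sc \<and> ?atom"
    then obtain A i where A: "lambda_superatom D A" "i < 2" "A \<subseteq> carrier G \<times> {i}" by blast
    define C where "C = fst ` A"
    have AC: "A = C \<times> {i}" using A(3) unfolding C_def by force
    have C: "C \<subseteq> carrier G" "2 \<le> card C"
      using A(1,3) AC unfolding lambda_superatom_def C_def[symmetric]
      by (auto simp: card_cartesian_product)
    have i': "1 - i < 2" by arith
    consider "card (leaving bi_arcs (C \<times> {i})) = ?d" | "card (leaving (bi_arcs\<inverse>) (C \<times> {i})) = ?d"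
      using A(1) lam unfolding lambda_superatom_def arc_fragment_def omega_plus_eq_leaving
        card_omega_minus arcs AC by auto
    then show ?R
    proof cases
      case 1
      note f = fragment_in_layer[OF C \<open>i < 2\<close> 1 out inn U_ne]
      have "card (U 0) = 1 \<or> card (U 1) = 1"
        using f(1) L A(2) by (metis less_2_cases One_nat_def)
      then show ?thesis using f(2-4) L A(2) by blast
    next
      case 2
      have d: "?d \<le> card (c.bi_arcs `` {(g, j)})" "?d \<le> card (c.bi_arcs\<inverse> `` {(g, j)})"
        if "g \<in> carrier G" "j < 2" for g j
        using out[OF that] inn[OF that] unfolding bi_arcs_converse[symmetric] by simp_all
      have "m_inv G ` U (1 - i) \<noteq> {}" using U_ne[OF _ i'] L by simp
      note f = c.fragment_in_layer[OF C \<open>i < 2\<close> 2[unfolded bi_arcs_converse] d this]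
      have "card (U (1 - i)) = 1" using f(1) U_sub by (simp add: card_inv_image)
      then have "card (U 0) = 1 \<or> card (U 1) = 1" using i' by (metis less_2_cases One_nat_def)
      moreover have "1 \<le> card (S i)" "card (S i) \<le> card (S (1 - i))"
        using f(2,3) SG by (simp_all add: card_inv_image)
      moreover have "subgroup (S i \<union> {\<one>}) G"
        using f(4) subgroup_insert_one_inv_iff[OF SG] by blast
      ultimately show ?thesis using A(2) by blast
    qed
  next
    assume ?R
    then obtain i where i: "i < 2" and U1: "card (U 0) = 1 \<or> card (U 1) = 1"
      and S1: "1 \<le> card (S i)" "card (S i) \<le> card (S (1 - i))" and H: "subgroup (S i \<union> {\<one>}) G"
      by blast
    let ?H = "S i \<union> {\<one>}"
    have i': "1 - i < 2" "1 - (1 - i) = i" "1 - i \<noteq> i" using i by arith+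
    have two: "j = i \<or> j = 1 - i" if "j < 2" for j using that i by arith
    have V_ne: "pverts D \<noteq> {}" using verts i by auto
    have deg: "m \<le> ?d" if m: "\<And>j k. j < 2 \<Longrightarrow> k < 2 \<Longrightarrow> m \<le> card (S j) + card (U k)" for m
      using verts arcs m by (intro min_degree_ge finV V_ne)
        (auto simp: card_Image_bi_arcs card_Image_converse_bi_arcs)
    have S_le: "card (S i) \<le> card (S j)" if "j < 2" for j
      using two[OF that] S1 by auto
    \<comment> \<open>The bound is raised in two stages: \<open>card (S i)\<close> alone makes the
      arc-connectivity positive, hence the digraph strongly connected; then both \<open>U k\<close>
      are nonempty and the bound grows by 1.\<close>
    have "card (S i) \<le> ?d" using S_le by (intro deg) (simp add: trans_le_add1)
    then have sc: ?sc using S1 lam by (intro strongly_connected_if_arc_connectivity_pos) simp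
    have Upos: "1 \<le> card (U k)" if "k < 2" for k
      using U_ne[OF sc that] finite_U[of k] by (simp add: Suc_le_eq card_gt_0_iff)
    have ge: "card (S i) + 1 \<le> ?d" using S_le Upos by (intro deg add_mono)
    have cH: "card ?H = card (S i) + 1"
      using S_sub[of i] finite_S by (subst card_Un_disjoint) auto
    have cH': "card (?H \<times> {i}) = card (S i) + 1"
      using cH by (simp only: card_cartesian_product) simp
    have cut: "card (omega_plus D (?H \<times> {i})) = ?d \<or> card (omega_minus D (?H \<times> {i})) = ?d"
      and le: "?d \<le> card (S i) + 1"
    proof -
      consider "card (U i) = 1" | "card (U (1 - i)) = 1"
        using U1 two[of 0] two[of 1] by auto
      then have "?d \<le> card (S i) + 1 \<and>
        (card (omega_plus D (?H \<times> {i})) = card (S i) + 1 \<or>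
          card (omega_minus D (?H \<times> {i})) = card (S i) + 1)"
      proof cases
        case 1
        then show ?thesis
          using out[OF one_closed i] card_leaving_subgroup[OF i H]
          unfolding card_Image_bi_arcs[OF one_closed i] omega_plus_eq_leaving arcs by simp
      next
        case 2
        \<comment> \<open>A subgroup is invariant under inversion, so the same vertex set serves in
          the reversed digraph.\<close>
        have eq: "m_inv G ` S i \<union> {\<one>} = ?H" by (rule inv_image_Un_one[OF H])
        have "card (leaving (bi_arcs\<inverse>) (?H \<times> {i})) = card (S i) + 1"
          using c.card_leaving_subgroup[OF i] H 2 SG U_sub
          unfolding eq bi_arcs_converse by (simp add: card_inv_image)
        then show ?thesis
          using inn[OF one_closed i] 2
          unfolding card_Image_converse_bi_arcs[OF one_closed i] card_omega_minus arcs by simp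
      qed
      with ge show "?d \<le> card (S i) + 1"
        "card (omega_plus D (?H \<times> {i})) = ?d \<or> card (omega_minus D (?H \<times> {i})) = ?d" by auto
    qed
    have "(\<one>, 1 - i) \<in> pverts D" "(\<one>, 1 - i) \<notin> ?H \<times> {i}" using verts i' by auto
    moreover have "?H \<times> {i} \<subseteq> pverts D" using verts i SG by auto
    ultimately have "arc_fragment D (?H \<times> {i})"
      using cut lam unfolding arc_fragment_def by auto
    \<comment> \<open>Minimality: \<open>?H \<times> {i}\<close> has exactly as many vertices as the
      minimum degree, the lower bound for all such fragments.\<close>
    moreover have "card (?H \<times> {i}) \<le> card B" if "arc_fragment D B" "2 \<le> card B" for B
      using arc_fragment_card_ge[OF max finV _ _ that] finite_bi_arcs bi_arcs_irrefl ge cH' arcs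
      by simp
    ultimately have "lambda_superatom D (?H \<times> {i})"
      unfolding lambda_superatom_def using cH' S1 by simp
    moreover have "?H \<times> {i} \<subseteq> carrier G \<times> {i}" using SG by auto
    ultimately show "?sc \<and> ?atom" using sc i by blast
  qed
qed

end

section \<open>Transfer to mixed Cayley digraphs\<close>

theorem theorem4p8:
  fixes G :: "('g, 'm) monoid_scheme" and S0 S1 T0 T1 :: "'g set"
  assumes "group G" and "finite (carrier G)"
    and "S0 \<subseteq> carrier G - {\<one>\<^bsub>G\<^esub>}" and "S1 \<subseteq> carrier G - {\<one>\<^bsub>G\<^esub>}"
    and "T0 \<subseteq> carrier G" and "T1 \<subseteq> carrier G"
    and "max_lambda (mixed_cayley G S0 S1 T0 T1)"
    and "\<not> super_lambda (mixed_cayley G S0 S1 T0 T1)"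
    and "\<not> directed_cycle (mixed_cayley G S0 S1 T0 T1)"
    and "\<not> cycle_digraph (mixed_cayley G S0 S1 T0 T1)"
    and "\<not> class_F G S0 S1 T0 T1"
  shows "class_G G S0 S1 T0 T1 \<longleftrightarrow>
      ((card T0 = 1 \<or> card T1 = 1) \<and> 1 \<le> card S0 \<and> card S0 \<le> card S1 \<and>
         subgroup (S0 \<union> {\<one>\<^bsub>G\<^esub>}) G)
    \<or> ((card T0 = 1 \<or> card T1 = 1) \<and> 1 \<le> card S1 \<and> card S1 \<le> card S0 \<and>
         subgroup (S1 \<union> {\<one>\<^bsub>G\<^esub>}) G)"
proof -
  interpret group G by (rule assms(1))
  define T1' where "T1' = m_inv G ` T1"
  let ?S = "\<lambda>i::nat. if i = 0 then S0 else S1"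
  let ?U = "\<lambda>i::nat. if i = 0 then T0 else T1'"
  let ?X = "mixed_cayley G S0 S1 T0 T1"
  interpret b: bicayley G ?S ?U
    using assms(2-6) by unfold_locales (auto simp: T1'_def)
  have two: "{..<2} = {0, Suc 0}" by auto
  have verts: "pverts ?X = carrier G \<times> {..<2}"
    unfolding mixed_cayley_def cay_def bd_def layer_def two by auto
  have l: "inv\<^bsub>G\<^esub> t \<otimes>\<^bsub>G\<^esub> (t \<otimes>\<^bsub>G\<^esub> g) = g" "t \<otimes>\<^bsub>G\<^esub> (inv\<^bsub>G\<^esub> t \<otimes>\<^bsub>G\<^esub> g) = g"
    if "t \<in> carrier G" "g \<in> carrier G" for t g
    using that by (simp_all add: m_assoc[symmetric])
  \<comment> \<open>The substitution of \<open>t \<otimes> g\<close> for the tail turns the head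
    into \<open>inv t\<close> times the tail, the form required by \<open>bi_arcs\<close>.\<close>
  have bd1: "{((t \<otimes>\<^bsub>G\<^esub> g, 1), (g, 0)) | g t. g \<in> carrier G \<and> t \<in> T1} =
      {((g, 1::nat), (u \<otimes>\<^bsub>G\<^esub> g, 0::nat)) | g u. g \<in> carrier G \<and> u \<in> T1'}" (is "?L = ?R")
  proof (intro equalityI subsetI)
    fix e assume "e \<in> ?L"
    then obtain g t where gt: "g \<in> carrier G" "t \<in> T1" "e = ((t \<otimes>\<^bsub>G\<^esub> g, 1), (g, 0))" by blast
    then have t: "t \<in> carrier G" using assms(6) by auto
    then have "e = ((t \<otimes>\<^bsub>G\<^esub> g, 1), (inv\<^bsub>G\<^esub> t \<otimes>\<^bsub>G\<^esub> (t \<otimes>\<^bsub>G\<^esub> g), 0))" using gt l by simp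
    then show "e \<in> ?R" using gt t unfolding T1'_def by blast
  next
    fix e assume "e \<in> ?R"
    then obtain g t where gt: "g \<in> carrier G" "t \<in> T1" "e = ((g, 1), (inv\<^bsub>G\<^esub> t \<otimes>\<^bsub>G\<^esub> g, 0))"
      unfolding T1'_def by blast
    then have t: "t \<in> carrier G" using assms(6) by auto
    then have "e = ((t \<otimes>\<^bsub>G\<^esub> (inv\<^bsub>G\<^esub> t \<otimes>\<^bsub>G\<^esub> g), 1), (inv\<^bsub>G\<^esub> t \<otimes>\<^bsub>G\<^esub> g, 0))" using gt l by simp
    then show "e \<in> ?L" using gt t by blast
  qed
  have ex2: "(\<exists>i<2. P i) \<longleftrightarrow> P 0 \<or> P 1" for P :: "nat \<Rightarrow> bool"
    by (auto simp: less_2_cases_iff)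
  have one_lt_2: "(1::nat) < 2" by simp
  have arcs: "parcs ?X = b.bi_arcs"
  proof (intro equalityI subsetI)
    fix e assume "e \<in> parcs ?X"
    \<comment> \<open>The targets are written \<open>1 - 0\<close> and \<open>1 - 1\<close> to match
      \<open>bi_arcsI\<close> literally.\<close>
    then consider
        g s where "e = ((g, 0), (s \<otimes>\<^bsub>G\<^esub> g, 0))" "g \<in> carrier G" "s \<in> ?S 0"
      | g s where "e = ((g, 1), (s \<otimes>\<^bsub>G\<^esub> g, 1))" "g \<in> carrier G" "s \<in> ?S 1"
      | g u where "e = ((g, 0), (u \<otimes>\<^bsub>G\<^esub> g, 1 - 0))" "g \<in> carrier G" "u \<in> ?U 0"
      | g u where "e = ((g, 1), (u \<otimes>\<^bsub>G\<^esub> g, 1 - 1))" "g \<in> carrier G" "u \<in> ?U 1"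
      unfolding mixed_cayley_def cay_def bd_def bd1 by auto
    then show "e \<in> b.bi_arcs"
      using b.bi_arcsI[OF _ pos2] b.bi_arcsI[OF _ one_lt_2] by cases blast+
  next
    fix e assume "e \<in> b.bi_arcs"
    then show "e \<in> parcs ?X"
      unfolding mixed_cayley_def cay_def bd_def bd1 b.bi_arcs_def by (auto simp: less_2_cases_iff)
  qed
  have "card T1' = card T1" unfolding T1'_def using assms(6) by (rule card_inv_image)
  then show ?thesis
    using b.superatom_in_layer_iff[OF verts arcs assms(7)]
    unfolding class_G_def layer_def ex2 by simp
qed

end
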